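(* Let $(G,H)$ be a skew bracoid, with $H$ a subgroup of $G$ on which the additive group structure is defined and such that $g\odot e$ is the unique $h\in H$ with $g\in hS$, where $S=\mathrm{Stab}_G(e)$; suppose that $(G,H)$ is almost a brace with respect to $H$. Then the solution $\boldsymbol r$ on $G$ associated with $(G,H)$ is isomorphic to a semi-direct product of a solution on $H$ and a solution on $S$.
   Context: A skew bracoid $(G,\cdot,N,\star,\odot)$ consists of two groups $(G,\cdot)$ and $(N,\star)$ and a transitive action $\odot$ of $G$ on the set $N$ such that $g\odot(\eta_1\star\eta_2)=(g\odot\eta_1)\star(g\odot e_N)^{-1}\star(g\odot\eta_2)$ for all $g\in G$, $\eta_1,\eta_2\in N$. It is almost a brace with respect to $H$ if $H$ is a normal subgroup of $G$ with $G=HS$ and $H\cap S$ trivial, where $S=\mathrm{Stab}_G(e_N)$. The notation $(G,H)$: if $H\le G$ is a complement to $S$, then $h\mapsto h\odot e_N$ is a bijection $H\to N$; transferring the additive group structure and the action from $N$ to $H$ along it gives a skew bracoid $(G,H)$ whose additive group is the set $H$ with an operation $\star$, with identity $e=e_G$, and with $h\odot h'=hh'$ for $h,h'\in H$ and $s\odot e=e$ for $s\in S$. A solution (to the set-theoretic Yang-Baxter equation) on a set $Y$ is a map $\boldsymbol r:Y\times Y\to Y\times Y$ with $(\boldsymbol r\times\mathrm{id})(\mathrm{id}\times\boldsymbol r)(\boldsymbol r\times\mathrm{id})=(\mathrm{id}\times\boldsymbol r)(\boldsymbol r\times\mathrm{id})(\mathrm{id}\times\boldsymbol r)$. Two solutions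 $(Y,\boldsymbol r)$, $(Y',\boldsymbol r')$ are isomorphic if there is a bijection $f:Y\to Y'$ with $(f\times f)\boldsymbol r=\boldsymbol r'(f\times f)$. The solution associated with $(G,H)$: with $\gamma_g(h)=(g\odot e)^{-1}\star(g\odot h)$ for $g\in G$, $h\in H$ (inverse with respect to $\star$), put $\sigma_{g_1}(g_2)=\gamma_{g_1}(g_2\odot e)\in H\subseteq G$ and $\tau_{g_2}(g_1)=\sigma_{g_1}(g_2)^{-1}g_1g_2$ (inverse and products in $(G,\cdot)$); the solution is $\boldsymbol r(g_1,g_2)=(\sigma_{g_1}(g_2),\tau_{g_2}(g_1))$. Semi-direct product of solutions (a matched product of solutions in the sense of Catino, Colazzo and Stefanelli in which one of the two actions is trivial): let $(S,\boldsymbol r_S)$, $\boldsymbol r_S(a,b)=(\lambda_a(b),\rho_b(a))$, and $(T,\boldsymbol r_T)$, $\boldsymbol r_T(u,v)=(\lambda_u(v),\rho_v(u))$, be solutions, and let $\beta:S\to\mathrm{Perm}(T)$, $a\mapsto\beta_a$, be such that each $\beta_a$ is an automorphism of $(T,\boldsymbol r_T)$ and $\beta_a\beta_b=\beta_{\lambda_a(b)}\beta_{\rho_b(a)}$ for all $a,b\in S$. The corresponding semi-direct product is the solution on $S\times T$ given by $$\big((a,u),(b,v)\big)\mapsto\Big(\big(\lambda_a(b),\ \lambda_u(\beta_a(v))\big),\ \big(\rho_b(a),\ \beta_{\lambda_a(b)}^{-1}\rho_{\beta_a(v)}(u)\big)\Big).$$ *)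

theory Defs
  imports "HOL-Algebra.Algebra"
begin

text \<open>
  The action is the library's notion, so each \<open>act g\<close> is a permutation of
  \<open>carrier N\<close> that is (by convention) undefined outside \<open>carrier N\<close>.
\<close>

locale skew_bracoid = G: group G + N: group N + transitive_action G "carrier N" act
  for G (structure) and N (structure) and act +
  assumes act_mult:
    "\<lbrakk>g \<in> carrier G; x \<in> carrier N; y \<in> carrier N\<rbrakk> \<Longrightarrow>
      act g (x \<otimes>\<^bsub>N\<^esub> y) = act g x \<otimes>\<^bsub>N\<^esub> inv\<^bsub>N\<^esub> (act g \<one>\<^bsub>N\<^esub>) \<otimes>\<^bsub>N\<^esub> act g y"

definition stab :: "('g, 'm) monoid_scheme \<Rightarrow> ('n, 'k) monoid_scheme \<Rightarrow> ('g \<Rightarrow> 'n \<Rightarrow> 'n) \<Rightarrow> 'g set"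
  where "stab G N act = stabilizer G act \<one>\<^bsub>N\<^esub>"

definition almost_a_brace ::
    "('g, 'm) monoid_scheme \<Rightarrow> ('n, 'k) monoid_scheme \<Rightarrow> ('g \<Rightarrow> 'n \<Rightarrow> 'n) \<Rightarrow> 'g set \<Rightarrow> bool"
  where "almost_a_brace G N act H \<longleftrightarrow>
    H \<lhd> G \<and> carrier G = H <#>\<^bsub>G\<^esub> stab G N act \<and> H \<inter> stab G N act = {\<one>\<^bsub>G\<^esub>}"

text \<open>
  The skew bracoid \<open>(G, H)\<close>: the additive group \<open>A\<close> lives on the subgroup \<open>H\<close> of \<open>G\<close>, and
  \<open>act g \<one>\<close> is the unique \<open>h \<in> H\<close> with \<open>g \<in> h S\<close>. The latter forces \<open>H\<close> to be a complement of
  \<open>S\<close> and \<open>act h h' = h \<otimes> h'\<close> for \<open>h, h' \<in> H\<close>; see the lemmas below.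
\<close>

locale subgroup_skew_bracoid = skew_bracoid G A act
  for G :: "('g, 'm) monoid_scheme" (structure)
    and A :: "('g, 'k) monoid_scheme" (structure)
    and act :: "'g \<Rightarrow> 'g \<Rightarrow> 'g" +
  fixes H :: "'g set"
  assumes H_subgroup: "subgroup H G"
    and carrier_A: "carrier A = H"
    and one_A: "\<one>\<^bsub>A\<^esub> = \<one>\<^bsub>G\<^esub>"
    and act_one_in: "g \<in> carrier G \<Longrightarrow> act g \<one>\<^bsub>A\<^esub> \<in> H"
    and act_one_coset: "g \<in> carrier G \<Longrightarrow> g \<in> act g \<one>\<^bsub>A\<^esub> <#\<^bsub>G\<^esub> stab G A act"
    and act_one_unique:
      "\<lbrakk>g \<in> carrier G; h \<in> H; g \<in> h <#\<^bsub>G\<^esub> stab G A act\<rbrakk> \<Longrightarrow> h = act g \<one>\<^bsub>A\<^esub>"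
begin

lemma one_in_stab: "\<one>\<^bsub>G\<^esub> \<in> stab G A act"
  unfolding stab_def by (rule stabilizer_one_closed) (rule N.one_closed)

lemma act_subgroup_one:
  assumes "h \<in> H" shows "act h \<one>\<^bsub>G\<^esub> = h"
proof -
  have h: "h \<in> carrier G" by (rule subgroup.mem_carrier[OF H_subgroup assms])
  have "h \<otimes>\<^bsub>G\<^esub> \<one>\<^bsub>G\<^esub> \<in> h <#\<^bsub>G\<^esub> stab G A act"
    unfolding l_coset_def using one_in_stab by blast
  then have "h \<in> h <#\<^bsub>G\<^esub> stab G A act"
    by (simp only: G.r_one[OF h])
  from act_one_unique[OF h assms this] show ?thesis by (simp only: one_A)
qed

lemma act_subgroup_mult:
  assumes "h \<in> H" "h' \<in> H" shows "act h h' = h \<otimes>\<^bsub>G\<^esub> h'"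
proof -
  note c = assms[THEN subgroup.mem_carrier[OF H_subgroup]]
  have "act (h \<otimes>\<^bsub>G\<^esub> h') \<one>\<^bsub>A\<^esub> = act h (act h' \<one>\<^bsub>A\<^esub>)"
    by (rule composition_rule[OF N.one_closed c])
  then show ?thesis
    by (simp only: one_A act_subgroup_one assms subgroup.m_closed[OF H_subgroup])
qed

lemma subgroup_complement: "H \<inter> stab G A act = {\<one>\<^bsub>G\<^esub>}"
proof -
  have "h = \<one>\<^bsub>G\<^esub>" if "h \<in> H" "h \<in> stab G A act" for h
  proof -
    have "act h \<one>\<^bsub>G\<^esub> = \<one>\<^bsub>G\<^esub>"
      using that(2) unfolding stab_def stabilizer_def one_A by (elim CollectE conjE)
    then show ?thesis by (rule trans[OF act_subgroup_one[OF that(1), symmetric]])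
  qed
  then show ?thesis using one_in_stab subgroup.one_closed[OF H_subgroup] by blast
qed

end

text \<open>
  A map on \<open>Y \<times> Y\<close> is represented by a function on the ambient type; only its values on
  \<open>Y \<times> Y\<close> matter.
\<close>

definition r12 :: "('a \<times> 'a \<Rightarrow> 'a \<times> 'a) \<Rightarrow> 'a \<times> 'a \<times> 'a \<Rightarrow> 'a \<times> 'a \<times> 'a"
  where "r12 r = (\<lambda>(x, y, z). (fst (r (x, y)), snd (r (x, y)), z))"

definition r23 :: "('a \<times> 'a \<Rightarrow> 'a \<times> 'a) \<Rightarrow> 'a \<times> 'a \<times> 'a \<Rightarrow> 'a \<times> 'a \<times> 'a"
  where "r23 r = (\<lambda>(x, y, z). (x, r (y, z)))"

definition ybe_solution :: "'a set \<Rightarrow> ('a \<times> 'a \<Rightarrow> 'a \<times> 'a) \<Rightarrow> bool"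
  where "ybe_solution Y r \<longleftrightarrow>
    r \<in> Y \<times> Y \<rightarrow> Y \<times> Y \<and>
    (\<forall>t \<in> Y \<times> Y \<times> Y. (r12 r \<circ> r23 r \<circ> r12 r) t = (r23 r \<circ> r12 r \<circ> r23 r) t)"

definition solution_iso ::
    "('a \<Rightarrow> 'b) \<Rightarrow> 'a set \<Rightarrow> ('a \<times> 'a \<Rightarrow> 'a \<times> 'a) \<Rightarrow> 'b set \<Rightarrow> ('b \<times> 'b \<Rightarrow> 'b \<times> 'b) \<Rightarrow> bool"
  where "solution_iso f Y r Y' r' \<longleftrightarrow>
    bij_betw f Y Y' \<and> (\<forall>p \<in> Y \<times> Y. map_prod f f (r p) = r' (map_prod f f p))"

definition isomorphic_solutions ::
    "'a set \<Rightarrow> ('a \<times> 'a \<Rightarrow> 'a \<times> 'a) \<Rightarrow> 'b set \<Rightarrow> ('b \<times> 'b \<Rightarrow> 'b \<times> 'b) \<Rightarrow> bool"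
  where "isomorphic_solutions Y r Y' r' \<longleftrightarrow>
    ybe_solution Y r \<and> ybe_solution Y' r' \<and> (\<exists>f. solution_iso f Y r Y' r')"

definition gamma ::
    "('n, 'k) monoid_scheme \<Rightarrow> ('g \<Rightarrow> 'n \<Rightarrow> 'n) \<Rightarrow> 'g \<Rightarrow> 'n \<Rightarrow> 'n"
  where "gamma A act g h = inv\<^bsub>A\<^esub> (act g \<one>\<^bsub>A\<^esub>) \<otimes>\<^bsub>A\<^esub> act g h"

definition bracoid_sigma ::
    "('g, 'k) monoid_scheme \<Rightarrow> ('g \<Rightarrow> 'g \<Rightarrow> 'g) \<Rightarrow> 'g \<Rightarrow> 'g \<Rightarrow> 'g"
  where "bracoid_sigma A act g1 g2 = gamma A act g1 (act g2 \<one>\<^bsub>A\<^esub>)"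

definition bracoid_tau ::
    "('g, 'm) monoid_scheme \<Rightarrow> ('g, 'k) monoid_scheme \<Rightarrow> ('g \<Rightarrow> 'g \<Rightarrow> 'g) \<Rightarrow> 'g \<Rightarrow> 'g \<Rightarrow> 'g"
  where "bracoid_tau G A act g2 g1 =
    inv\<^bsub>G\<^esub> (bracoid_sigma A act g1 g2) \<otimes>\<^bsub>G\<^esub> g1 \<otimes>\<^bsub>G\<^esub> g2"

definition bracoid_solution ::
    "('g, 'm) monoid_scheme \<Rightarrow> ('g, 'k) monoid_scheme \<Rightarrow> ('g \<Rightarrow> 'g \<Rightarrow> 'g) \<Rightarrow> 'g \<times> 'g \<Rightarrow> 'g \<times> 'g"
  where "bracoid_solution G A act =
    (\<lambda>(g1, g2). (bracoid_sigma A act g1 g2, bracoid_tau G A act g2 g1))"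

text \<open>
  For \<open>r (a, b) = (\<lambda>\<^sub>a(b), \<rho>\<^sub>b(a))\<close>, \<open>lam r a b\<close> is \<open>\<lambda>\<^sub>a(b)\<close> and \<open>rho r b a\<close> is \<open>\<rho>\<^sub>b(a)\<close>.
\<close>

definition lam :: "('a \<times> 'a \<Rightarrow> 'a \<times> 'a) \<Rightarrow> 'a \<Rightarrow> 'a \<Rightarrow> 'a"
  where "lam r a b = fst (r (a, b))"

definition rho :: "('a \<times> 'a \<Rightarrow> 'a \<times> 'a) \<Rightarrow> 'a \<Rightarrow> 'a \<Rightarrow> 'a"
  where "rho r b a = snd (r (a, b))"

definition semidirect_data ::
    "'s set \<Rightarrow> ('s \<times> 's \<Rightarrow> 's \<times> 's) \<Rightarrow> 't set \<Rightarrow> ('t \<times> 't \<Rightarrow> 't \<times> 't) \<Rightarrow> ('s \<Rightarrow> 't \<Rightarrow> 't) \<Rightarrow> bool"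
  where "semidirect_data S rS T rT \<beta> \<longleftrightarrow>
    ybe_solution S rS \<and> ybe_solution T rT \<and>
    (\<forall>a \<in> S. solution_iso (\<beta> a) T rT T rT) \<and>
    (\<forall>a \<in> S. \<forall>b \<in> S. \<forall>u \<in> T. \<beta> a (\<beta> b u) = \<beta> (lam rS a b) (\<beta> (rho rS b a) u))"

definition semidirect_solution ::
    "('s \<times> 's \<Rightarrow> 's \<times> 's) \<Rightarrow> 't set \<Rightarrow> ('t \<times> 't \<Rightarrow> 't \<times> 't) \<Rightarrow> ('s \<Rightarrow> 't \<Rightarrow> 't) \<Rightarrow>
      ('s \<times> 't) \<times> ('s \<times> 't) \<Rightarrow> ('s \<times> 't) \<times> ('s \<times> 't)"
  where "semidirect_solution rS T rT \<beta> =
    (\<lambda>((a, u), (b, v)).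
      ((lam rS a b, lam rT u (\<beta> a v)),
       (rho rS b a, inv_into T (\<beta> (lam rS a b)) (rho rT (\<beta> a v) u))))"

end

theory Submission
  imports Defs
begin

text \<open>
  Write \<open>g \<odot> x\<close> for \<open>act g x\<close>, \<open>e\<close> for the identity and \<open>S\<close> for its stabiliser.  The maps
  \<open>\<gamma>\<^sub>g\<close> form an action of \<open>G\<close> on the additive group by automorphisms, and
  \<open>h h' = h \<odot> h' = h \<star> \<gamma>\<^sub>h(h')\<close> on \<open>H\<close>.  These two facts give \<open>\<sigma>\<close> the two laws of
  a braiding on the group \<open>G\<close> (lemmas \<open>sigma_mult\<close> and \<open>sigma_prod\<close>), and any such \<open>\<sigma>\<close>
  yields a solution because \<open>\<sigma>\<^sub>a(b) \<tau>\<^sub>b(a) = a b\<close> (lemma \<open>ybe_solution_if_braiding\<close>).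

  Suppose now that \<open>H\<close> is normal.  For \<open>s \<in> S\<close> and \<open>h \<in> H\<close> the element \<open>s h\<close> lies in
  \<open>(s h s\<inverse>) S\<close>, so \<open>\<gamma>\<^sub>s\<close> is conjugation by \<open>s\<close> and preserves both group structures of \<open>H\<close>.
  Writing \<open>g\<^sub>i = h\<^sub>i s\<^sub>i\<close> and \<open>k = \<gamma>\<^bsub>s\<^sub>1\<^esub>(h\<^sub>2)\<close>, one has
  \<open>\<sigma>\<^bsub>g\<^sub>1\<^esub>(g\<^sub>2) = \<gamma>\<^bsub>h\<^sub>1\<^esub>(\<gamma>\<^bsub>s\<^sub>1\<^esub>(h\<^sub>2)) = \<sigma>\<^bsub>h\<^sub>1\<^esub>(k)\<close>, and \<open>g\<^sub>1 g\<^sub>2 = h\<^sub>1 k s\<^sub>1 s\<^sub>2\<close> then gives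
  \<open>\<tau>\<^bsub>g\<^sub>2\<^esub>(g\<^sub>1) = \<tau>\<^sub>k(h\<^sub>1) s\<^sub>1 s\<^sub>2\<close>.
  Reading off the two components, the map \<open>h s \<mapsto> (s, h)\<close> identifies the solution on \<open>G\<close> with the
  semi-direct product of its own restriction to \<open>H\<close> and the solution \<open>(a, b) \<mapsto> (e, a b)\<close> on \<open>S\<close>,
  with \<open>\<beta> = \<gamma>\<close>.  The Yang--Baxter equation is inherited from \<open>G\<close> by the solution on \<open>H\<close>, a
  restriction, and by the semi-direct product, a transport along this bijection; on \<open>S\<close> it is
  immediate, since both sides send \<open>(a, b, c)\<close> to \<open>(e, e, a b c)\<close>.
\<close>

section \<open>Yang--Baxter solutions\<close>

lemma ybe_solutionI:
  assumes "\<And>x y. \<lbrakk>x \<in> Y; y \<in> Y\<rbrakk> \<Longrightarrow> l x y \<in> Y \<and> t x y \<in> Y"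
    and "\<And>x y z. \<lbrakk>x \<in> Y; y \<in> Y; z \<in> Y\<rbrakk> \<Longrightarrow>
      l (l x y) (l (t x y) z) = l x (l y z) \<and>
      t (l x y) (l (t x y) z) = l (t x (l y z)) (t y z) \<and>
      t (t x y) z = t (t x (l y z)) (t y z)"
  shows "ybe_solution Y (\<lambda>(x, y). (l x y, t x y))"
proof -
  have "(\<lambda>(x, y). (l x y, t x y)) \<in> Y \<times> Y \<rightarrow> Y \<times> Y"
    using assms(1) by fast
  then show ?thesis
    by (simp add: ybe_solution_def r12_def r23_def assms(2))
qed

lemma ybe_solution_subset:
  assumes "ybe_solution Y r" "Z \<subseteq> Y" "r \<in> Z \<times> Z \<rightarrow> Z \<times> Z"
  shows "ybe_solution Z r"
  using assms unfolding ybe_solution_def by blast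

lemma ybe_solution_transport:
  assumes r: "ybe_solution Y r" and iso: "solution_iso f Y r Y' r'"
  shows "ybe_solution Y' r'"
proof -
  have f: "f ` Y = Y'" and eq: "\<And>x y. x \<in> Y \<Longrightarrow> y \<in> Y \<Longrightarrow> r' (f x, f y) = map_prod f f (r (x, y))"
    using iso by (auto simp: solution_iso_def bij_betw_def)
  have cl: "r (x, y) \<in> Y \<times> Y" if "x \<in> Y" "y \<in> Y" for x y
    using r that by (auto simp: ybe_solution_def)
  define F where "F = map_prod f (map_prod f f)"
  have r12: "r12 r t \<in> Y \<times> Y \<times> Y" "r12 r' (F t) = F (r12 r t)" if "t \<in> Y \<times> Y \<times> Y" for t
    using that cl eq by (cases t; auto simp: r12_def F_def mem_Times_iff)+
  have r23: "r23 r t \<in> Y \<times> Y \<times> Y" "r23 r' (F t) = F (r23 r t)" if "t \<in> Y \<times> Y \<times> Y" for t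
    using that cl eq by (cases t; auto simp: r23_def F_def mem_Times_iff)+
  have "(r12 r' \<circ> r23 r' \<circ> r12 r') t = (r23 r' \<circ> r12 r' \<circ> r23 r') t" if "t \<in> Y' \<times> Y' \<times> Y'" for t
  proof -
    obtain u where u: "u \<in> Y \<times> Y \<times> Y" "t = F u"
      using \<open>t \<in> Y' \<times> Y' \<times> Y'\<close> f unfolding F_def by (auto simp: image_iff)
    have "(r12 r \<circ> r23 r \<circ> r12 r) u = (r23 r \<circ> r12 r \<circ> r23 r) u"
      using r u(1) by (auto simp: ybe_solution_def)
    then show ?thesis using u r12 r23 by simp
  qed
  moreover have "r' \<in> Y' \<times> Y' \<rightarrow> Y' \<times> Y'"
    using f eq cl by (auto simp: mem_Times_iff Pi_iff)
  ultimately show ?thesis by (simp add: ybe_solution_def)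
qed

lemma (in group) mult_inv_mult_cancel:
  assumes "x \<in> carrier G" "y \<in> carrier G"
  shows "x \<otimes> (inv x \<otimes> y) = y" and "inv x \<otimes> (x \<otimes> y) = y"
  using assms by (simp_all add: m_assoc[symmetric])

text \<open>
  The product of a pair, hence of a triple, is preserved.  Both sides of the Yang--Baxter equation
  therefore agree as soon as their first two entries do; the first entries are both
  \<open>\<sigma>\<^bsub>a b\<^esub>(c)\<close>, and the product of the first two is \<open>\<sigma>\<^sub>a(b c)\<close> on either side.
\<close>

lemma (in group) ybe_solution_if_braiding:
  fixes s :: "'a \<Rightarrow> 'a \<Rightarrow> 'a"
  defines "t a b \<equiv> inv (s a b) \<otimes> a \<otimes> b"
  assumes s: "\<And>a b. \<lbrakk>a \<in> carrier G; b \<in> carrier G\<rbrakk> \<Longrightarrow> s a b \<in> carrier G"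
    and s_mult: "\<And>a b c. \<lbrakk>a \<in> carrier G; b \<in> carrier G; c \<in> carrier G\<rbrakk> \<Longrightarrow>
      s (a \<otimes> b) c = s a (s b c)"
    and s_prod: "\<And>a b c. \<lbrakk>a \<in> carrier G; b \<in> carrier G; c \<in> carrier G\<rbrakk> \<Longrightarrow>
      s a (b \<otimes> c) = s a b \<otimes> s (t a b) c"
  shows "ybe_solution (carrier G) (\<lambda>(a, b). (s a b, t a b))"
proof (rule ybe_solutionI)
  have t: "t a b \<in> carrier G" if "a \<in> carrier G" "b \<in> carrier G" for a b
    using that s by (simp add: t_def)
  then show "s a b \<in> carrier G \<and> t a b \<in> carrier G" if "a \<in> carrier G" "b \<in> carrier G" for a b
    using that s by simp
  have st: "s a b \<otimes> t a b = a \<otimes> b" if "a \<in> carrier G" "b \<in> carrier G" for a b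
    using that s by (simp add: t_def m_assoc mult_inv_mult_cancel)
  fix a b c assume abc [simp]: "a \<in> carrier G" "b \<in> carrier G" "c \<in> carrier G"
  note [simp] = s t
  let ?l1 = "s (s a b) (s (t a b) c)" and ?r1 = "s a (s b c)"
  let ?l2 = "t (s a b) (s (t a b) c)" and ?r2 = "s (t a (s b c)) (t b c)"
  let ?l3 = "t (t a b) c" and ?r3 = "t (t a (s b c)) (t b c)"
  have 1: "?l1 = ?r1"
    by (simp add: s_mult[symmetric] st)
  have "?l1 \<otimes> ?l2 = s a (b \<otimes> c)"
    by (simp add: st s_prod)
  also have "\<dots> = ?r1 \<otimes> ?r2"
    by (simp add: st s_prod[symmetric])
  finally have 2: "?l2 = ?r2"
    by (simp add: 1)
  have st': "s x y \<otimes> (t x y \<otimes> z) = x \<otimes> (y \<otimes> z)"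
    if "x \<in> carrier G" "y \<in> carrier G" "z \<in> carrier G" for x y z
    using st that by (simp add: m_assoc[symmetric])
  have "?l1 \<otimes> ?l2 \<otimes> ?l3 = a \<otimes> b \<otimes> c"
    by (simp add: m_assoc st st')
  also have "\<dots> = ?r1 \<otimes> ?r2 \<otimes> ?r3"
    by (simp add: m_assoc st st')
  finally have "?l3 = ?r3"
    by (simp add: 1 2)
  with 1 2 show "?l1 = ?r1 \<and> ?l2 = ?r2 \<and> ?l3 = ?r3" by blast
qed

section \<open>The solution on the acting group\<close>

lemma (in skew_bracoid) act_closed:
  assumes "g \<in> carrier G" "x \<in> carrier N" shows "act g x \<in> carrier N"
  using element_image[OF assms] by simp

lemma (in skew_bracoid) gamma_closed:
  assumes "g \<in> carrier G" "x \<in> carrier N" shows "gamma N act g x \<in> carrier N"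
  using assms by (simp add: gamma_def act_closed)

lemma (in skew_bracoid) act_eq_gamma:
  assumes "g \<in> carrier G" "x \<in> carrier N"
  shows "act g x = act g \<one>\<^bsub>N\<^esub> \<otimes>\<^bsub>N\<^esub> gamma N act g x"
  using assms by (simp add: gamma_def act_closed N.m_assoc[symmetric])

lemma (in skew_bracoid) gamma_add:
  assumes "g \<in> carrier G" "x \<in> carrier N" "y \<in> carrier N"
  shows "gamma N act g (x \<otimes>\<^bsub>N\<^esub> y) = gamma N act g x \<otimes>\<^bsub>N\<^esub> gamma N act g y"
  using assms by (simp add: gamma_def act_mult act_closed N.m_assoc)

text \<open>
  Applying \<open>g\<^sub>1\<close> to \<open>act_eq_gamma\<close> for \<open>g\<^sub>2\<close> turns its right-hand side, by the bracoid law, into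
  \<open>(g\<^sub>1 g\<^sub>2 \<odot> e) \<star> \<gamma>\<^bsub>g\<^sub>1\<^esub>(\<gamma>\<^bsub>g\<^sub>2\<^esub>(x))\<close>; now cancel.
\<close>

lemma (in skew_bracoid) gamma_mult:
  assumes g: "g1 \<in> carrier G" "g2 \<in> carrier G" and x: "x \<in> carrier N"
  shows "gamma N act (g1 \<otimes> g2) x = gamma N act g1 (gamma N act g2 x)"
proof -
  have "act (g1 \<otimes> g2) x = act g1 (act g2 \<one>\<^bsub>N\<^esub> \<otimes>\<^bsub>N\<^esub> gamma N act g2 x)"
    using g x by (simp add: composition_rule flip: act_eq_gamma)
  also have "\<dots> = act (g1 \<otimes> g2) \<one>\<^bsub>N\<^esub> \<otimes>\<^bsub>N\<^esub> gamma N act g1 (gamma N act g2 x)"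
    using g x by (simp add: act_mult composition_rule act_closed gamma_closed gamma_def N.m_assoc)
  finally show ?thesis
    using g x by (simp add: act_eq_gamma[of "g1 \<otimes> g2" x] act_closed gamma_closed)
qed

lemma (in skew_bracoid) gamma_one:
  assumes "x \<in> carrier N" shows "gamma N act \<one> x = x"
  using assms by (simp add: gamma_def flip: id_eq_one)

context subgroup_skew_bracoid
begin

lemma act_stab_one: "s \<in> stab G A act \<Longrightarrow> act s \<one>\<^bsub>A\<^esub> = \<one>\<^bsub>A\<^esub>"
  by (simp add: stab_def stabilizer_def)

lemma subgroup_mult_eq_gamma:
  assumes "h \<in> H" "h' \<in> H" shows "h \<otimes> h' = h \<otimes>\<^bsub>A\<^esub> gamma A act h h'"
  using act_eq_gamma[of h h'] assms act_subgroup_mult act_subgroup_one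
  by (simp add: carrier_A one_A subgroup.mem_carrier[OF H_subgroup])

lemma sigma_in_subgroup:
  assumes "a \<in> carrier G" "b \<in> carrier G" shows "bracoid_sigma A act a b \<in> H"
  using assms gamma_closed act_one_in by (simp add: bracoid_sigma_def carrier_A)

lemma sigma_mult:
  assumes "a \<in> carrier G" "b \<in> carrier G" "c \<in> carrier G"
  shows "bracoid_sigma A act (a \<otimes> b) c = bracoid_sigma A act a (bracoid_sigma A act b c)"
proof -
  have "act (bracoid_sigma A act b c) \<one>\<^bsub>A\<^esub> = bracoid_sigma A act b c"
    using assms sigma_in_subgroup act_subgroup_one by (simp add: one_A)
  then show ?thesis
    using assms act_one_in unfolding bracoid_sigma_def by (simp add: gamma_mult carrier_A)
qed

text \<open>
  With \<open>p = \<sigma>\<^sub>a(b)\<close> and \<open>q = \<sigma>\<^bsub>\<tau>\<^sub>b(a)\<^esub>(c)\<close>, both in \<open>H\<close>, one has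
  \<open>p q = p \<star> \<gamma>\<^sub>p(q) = p \<star> \<sigma>\<^bsub>a b\<^esub>(c) = \<gamma>\<^sub>a((b \<odot> e) \<star> \<gamma>\<^sub>b(c \<odot> e)) = \<gamma>\<^sub>a(b c \<odot> e)\<close>.
\<close>

lemma sigma_prod:
  assumes abc [simp]: "a \<in> carrier G" "b \<in> carrier G" "c \<in> carrier G"
  shows "bracoid_sigma A act a (b \<otimes> c) =
    bracoid_sigma A act a b \<otimes> bracoid_sigma A act (bracoid_tau G A act b a) c"
proof -
  let ?p = "bracoid_sigma A act a b" and ?t = "bracoid_tau G A act b a"
  let ?q = "bracoid_sigma A act ?t c"
  have p: "?p \<in> H" and pc [simp]: "?p \<in> carrier G"
    using sigma_in_subgroup subgroup.mem_carrier[OF H_subgroup] by auto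
  have t [simp]: "?t \<in> carrier G" and pt: "?p \<otimes> ?t = a \<otimes> b"
    by (simp_all add: bracoid_tau_def G.m_assoc G.mult_inv_mult_cancel)
  have q: "?q \<in> H" using sigma_in_subgroup by simp
  have H: "act b \<one>\<^bsub>A\<^esub> \<in> carrier A" "act c \<one>\<^bsub>A\<^esub> \<in> carrier A"
    using act_one_in by (simp_all add: carrier_A)
  have "?p \<otimes> ?q = ?p \<otimes>\<^bsub>A\<^esub> gamma A act ?p ?q"
    by (rule subgroup_mult_eq_gamma[OF p q])
  also have "gamma A act ?p ?q = gamma A act (a \<otimes> b) (act c \<one>\<^bsub>A\<^esub>)"
    using H by (simp add: bracoid_sigma_def[of A act ?t] gamma_mult[symmetric] pt)
  also have "?p \<otimes>\<^bsub>A\<^esub> gamma A act (a \<otimes> b) (act c \<one>\<^bsub>A\<^esub>) =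
      gamma A act a (act b \<one>\<^bsub>A\<^esub> \<otimes>\<^bsub>A\<^esub> gamma A act b (act c \<one>\<^bsub>A\<^esub>))"
    using H by (simp add: bracoid_sigma_def gamma_mult gamma_add gamma_closed)
  also have "act b \<one>\<^bsub>A\<^esub> \<otimes>\<^bsub>A\<^esub> gamma A act b (act c \<one>\<^bsub>A\<^esub>) = act (b \<otimes> c) \<one>\<^bsub>A\<^esub>"
    using H by (simp add: composition_rule flip: act_eq_gamma)
  finally show ?thesis by (simp add: bracoid_sigma_def)
qed

lemma bracoid_solution_ybe: "ybe_solution (carrier G) (bracoid_solution G A act)"
  unfolding bracoid_solution_def bracoid_tau_def
  by (rule G.ybe_solution_if_braiding)
    (fact subgroup.mem_carrier[OF H_subgroup sigma_in_subgroup] sigma_mult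
      sigma_prod[unfolded bracoid_tau_def])+

lemma tau_in_subgroup:
  assumes "h \<in> H" "h' \<in> H" shows "bracoid_tau G A act h' h \<in> H"
  using assms sigma_in_subgroup H_subgroup subgroup.mem_carrier[OF H_subgroup]
  by (simp add: bracoid_tau_def subgroup.m_closed subgroup.m_inv_closed)

lemma bracoid_solution_subgroup_ybe: "ybe_solution H (bracoid_solution G A act)"
  by (rule ybe_solution_subset[OF bracoid_solution_ybe subgroup.subset[OF H_subgroup]])
    (auto simp: bracoid_solution_def tau_in_subgroup sigma_in_subgroup
      subgroup.mem_carrier[OF H_subgroup])

lemma sigma_eq_gamma: "h \<in> H \<Longrightarrow> bracoid_sigma A act g h = gamma A act g h"
  using act_subgroup_one by (simp add: bracoid_sigma_def one_A)

end

section \<open>The semi-direct product decomposition\<close>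

locale almost_brace = subgroup_skew_bracoid +
  assumes almost_brace: "almost_a_brace G A act H"
begin

abbreviation "S \<equiv> stab G A act"

lemma S_subgroup: "subgroup S G"
  unfolding stab_def by (rule stabilizer_subgroup) simp

lemma H_normal: "H \<lhd> G"
  using almost_brace by (simp add: almost_a_brace_def)

lemma H_carrier [simp]: "h \<in> H \<Longrightarrow> h \<in> carrier G"
  by (rule subgroup.mem_carrier[OF H_subgroup])

lemma S_carrier [simp]: "s \<in> S \<Longrightarrow> s \<in> carrier G"
  by (rule subgroup.mem_carrier[OF S_subgroup])

lemma act_one_mult_stab:
  assumes "h \<in> H" "s \<in> S" shows "act (h \<otimes> s) \<one>\<^bsub>A\<^esub> = h"
  using assms by (simp add: composition_rule act_stab_one) (simp add: one_A act_subgroup_one)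

lemma decompose:
  assumes "g \<in> carrier G" obtains h s where "h \<in> H" "s \<in> S" "g = h \<otimes> s"
  using act_one_in[OF assms] act_one_coset[OF assms] by (auto simp: l_coset_def)

lemma conj_in_H: "g \<in> carrier G \<Longrightarrow> h \<in> H \<Longrightarrow> g \<otimes> h \<otimes> inv g \<in> H"
  by (rule normal.inv_op_closed2[OF H_normal])

text \<open>
  This is where normality enters: \<open>s \<odot> h = s h \<odot> e\<close> and \<open>s h = (s h s\<inverse>) s\<close> with
  \<open>s h s\<inverse> \<in> H\<close>.
\<close>

lemma gamma_stab_eq_conj:
  assumes s: "s \<in> S" and h: "h \<in> H" shows "gamma A act s h = s \<otimes> h \<otimes> inv s"
proof -
  have "act s h = act (s \<otimes> h) \<one>\<^bsub>A\<^esub>"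
    using s h act_subgroup_one by (simp add: composition_rule) (simp add: one_A)
  also have "s \<otimes> h = (s \<otimes> h \<otimes> inv s) \<otimes> s"
    using s h by (simp add: G.m_assoc)
  also have "act \<dots> \<one>\<^bsub>A\<^esub> = s \<otimes> h \<otimes> inv s"
    using act_one_mult_stab[of "s \<otimes> h \<otimes> inv s" s] s h conj_in_H by simp
  finally show ?thesis
    using s h conj_in_H by (simp add: gamma_def act_stab_one carrier_A)
qed

lemma gamma_in_H: "g \<in> carrier G \<Longrightarrow> h \<in> H \<Longrightarrow> gamma A act g h \<in> H"
  using gamma_closed by (simp add: carrier_A)

lemma stab_mult_eq: "s \<in> S \<Longrightarrow> h \<in> H \<Longrightarrow> s \<otimes> h = gamma A act s h \<otimes> s"
  by (simp add: gamma_stab_eq_conj G.m_assoc)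

text \<open>
  For \<open>\<sigma>\<close> use \<open>s h = \<gamma>\<^sub>s(h) s\<close> and that \<open>\<gamma>\<close> is an action; for \<open>\<tau>\<close> use in addition that
  \<open>\<gamma>\<^sub>s\<close>, being conjugation, is multiplicative on \<open>H\<close>.
\<close>

lemma gamma_stab_solution_iso:
  assumes s: "s \<in> S"
  shows "solution_iso (gamma A act s) H (bracoid_solution G A act) H (bracoid_solution G A act)"
  unfolding solution_iso_def
proof (intro conjI ballI)
  show "bij_betw (gamma A act s) H H"
    by (rule bij_betw_byWitness[where f' = "gamma A act (inv s)"])
      (use s in \<open>auto simp: gamma_in_H gamma_one carrier_A gamma_mult[symmetric]\<close>)
  fix p assume "p \<in> H \<times> H"
  then obtain h h' where p: "p = (h, h')" and h: "h \<in> H" "h' \<in> H" by blast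
  let ?c = "gamma A act s"
  have sigma: "?c (bracoid_sigma A act h h') = bracoid_sigma A act (?c h) (?c h')"
    using s h stab_mult_eq[OF s h(1)]
    by (simp add: sigma_eq_gamma gamma_in_H gamma_mult[symmetric] carrier_A)
  have "?c (bracoid_tau G A act h' h) =
      s \<otimes> (inv (bracoid_sigma A act h h') \<otimes> h \<otimes> h') \<otimes> inv s"
    using s h tau_in_subgroup by (simp add: gamma_stab_eq_conj bracoid_tau_def)
  also have "\<dots> = inv (s \<otimes> bracoid_sigma A act h h' \<otimes> inv s) \<otimes> (s \<otimes> h \<otimes> inv s) \<otimes> (s \<otimes> h' \<otimes> inv s)"
    using s h sigma_in_subgroup[of h h']
    by (simp add: G.inv_mult_group G.m_assoc G.mult_inv_mult_cancel)
  also have "\<dots> = bracoid_tau G A act (?c h') (?c h)"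
    using s h sigma_in_subgroup[of h h']
    by (simp add: bracoid_tau_def sigma flip: gamma_stab_eq_conj)
  finally show "map_prod ?c ?c (bracoid_solution G A act p) =
      bracoid_solution G A act (map_prod ?c ?c p)"
    by (simp add: p bracoid_solution_def sigma)
qed

abbreviation stab_solution :: "'a \<times> 'a \<Rightarrow> 'a \<times> 'a"
  where "stab_solution \<equiv> \<lambda>(a, b). (\<one>, a \<otimes> b)"

lemma stab_solution_ybe: "ybe_solution S stab_solution"
  by (rule ybe_solutionI)
    (use S_subgroup in \<open>auto simp: subgroup.m_closed subgroup.one_closed G.m_assoc\<close>)

lemma semidirect_data_gamma:
  "semidirect_data S stab_solution H (bracoid_solution G A act) (gamma A act)"
  unfolding semidirect_data_def
  using stab_solution_ybe bracoid_solution_subgroup_ybe gamma_stab_solution_iso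
  by (simp add: lam_def rho_def gamma_mult gamma_one gamma_in_H carrier_A)

definition split :: "'a \<Rightarrow> 'a \<times> 'a"
  where "split g = (inv (act g \<one>\<^bsub>A\<^esub>) \<otimes> g, act g \<one>\<^bsub>A\<^esub>)"

lemma split_mult: "h \<in> H \<Longrightarrow> s \<in> S \<Longrightarrow> split (h \<otimes> s) = (s, h)"
  by (simp add: split_def act_one_mult_stab G.m_assoc[symmetric])

lemma split_bij: "bij_betw split (carrier G) (S \<times> H)"
proof (rule bij_betw_byWitness[where f' = "\<lambda>(s, h). h \<otimes> s"])
  show "\<forall>g\<in>carrier G. (case split g of (s, h) \<Rightarrow> h \<otimes> s) = g" and "split ` carrier G \<subseteq> S \<times> H"
    using split_mult by (fastforce elim: decompose)+
qed (auto simp: split_mult)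

lemma bracoid_solution_mult_stab:
  assumes h: "h1 \<in> H" "h2 \<in> H" and s: "s1 \<in> S" "s2 \<in> S"
  defines "k \<equiv> gamma A act s1 h2"
  shows "bracoid_sigma A act (h1 \<otimes> s1) (h2 \<otimes> s2) = bracoid_sigma A act h1 k"
    and "bracoid_tau G A act (h2 \<otimes> s2) (h1 \<otimes> s1) = bracoid_tau G A act k h1 \<otimes> (s1 \<otimes> s2)"
proof -
  have k [simp]: "k \<in> H" using h s by (simp add: k_def gamma_in_H)
  show sigma: "bracoid_sigma A act (h1 \<otimes> s1) (h2 \<otimes> s2) = bracoid_sigma A act h1 k"
    using h s sigma_eq_gamma[OF k]
    by (simp add: bracoid_sigma_def[of A act "h1 \<otimes> s1"] act_one_mult_stab gamma_mult carrier_A k_def)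
  have "(h1 \<otimes> s1) \<otimes> (h2 \<otimes> s2) = h1 \<otimes> (s1 \<otimes> h2) \<otimes> s2"
    using h s by (simp add: G.m_assoc)
  also have "\<dots> = h1 \<otimes> k \<otimes> (s1 \<otimes> s2)"
    using h s k by (simp add: stab_mult_eq[OF s(1) h(2)] G.m_assoc flip: k_def)
  finally show "bracoid_tau G A act (h2 \<otimes> s2) (h1 \<otimes> s1) = bracoid_tau G A act k h1 \<otimes> (s1 \<otimes> s2)"
    using h s k sigma_in_subgroup[of h1 k] by (simp add: bracoid_tau_def sigma G.m_assoc)
qed

lemma split_solution_iso:
  "solution_iso split (carrier G) (bracoid_solution G A act)
    (S \<times> H) (semidirect_solution stab_solution H (bracoid_solution G A act) (gamma A act))"
  unfolding solution_iso_def
proof (intro conjI ballI split_bij)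
  fix p assume "p \<in> carrier G \<times> carrier G"
  then obtain g1 g2 where p: "p = (g1, g2)" and g: "g1 \<in> carrier G" "g2 \<in> carrier G" by blast
  obtain h1 s1 where 1: "h1 \<in> H" "s1 \<in> S" "g1 = h1 \<otimes> s1" using decompose[OF g(1)] .
  obtain h2 s2 where 2: "h2 \<in> H" "s2 \<in> S" "g2 = h2 \<otimes> s2" using decompose[OF g(2)] .
  define k where "k = gamma A act s1 h2"
  have k: "k \<in> H" using 1 2 by (simp add: k_def gamma_in_H)
  have ss: "s1 \<otimes> s2 \<in> S" using 1 2 by (simp add: subgroup.m_closed[OF S_subgroup])
  have sigma_H: "bracoid_sigma A act h1 k \<in> H" using 1 k by (simp add: sigma_in_subgroup)
  have tau_H: "bracoid_tau G A act k h1 \<in> H" using 1 k by (simp add: tau_in_subgroup)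
  have split_H: "split h = (\<one>, h)" if "h \<in> H" for h
    using split_mult[OF that subgroup.one_closed[OF S_subgroup]] that by simp
  \<comment> \<open>The first entry of the solution on \<open>S\<close> is the identity, so the inverse of \<open>\<beta>\<close> in the
    semi-direct product is trivial.\<close>
  have beta_inv_id: "inv_into H (gamma A act \<one>) x = x" if "x \<in> H" for x
    using that by (intro inv_into_f_eq inj_onI) (simp_all add: gamma_one carrier_A)
  show "map_prod split split (bracoid_solution G A act p) =
      semidirect_solution stab_solution H (bracoid_solution G A act) (gamma A act)
        (map_prod split split p)"
    using 1 2 sigma_H tau_H ss bracoid_solution_mult_stab[OF 1(1) 2(1) 1(2) 2(2)]
    by (simp add: p bracoid_solution_def semidirect_solution_def lam_def rho_def split_mult split_H
        beta_inv_id flip: k_def)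
qed

end

theorem proposition6p1:
  fixes G :: "('g, 'm) monoid_scheme" and A :: "('g, 'k) monoid_scheme"
    and act :: "'g \<Rightarrow> 'g \<Rightarrow> 'g" and H :: "'g set"
  assumes "subgroup_skew_bracoid G A act H"
    and "almost_a_brace G A act H"
  shows "\<exists>(rH :: 'g \<times> 'g \<Rightarrow> 'g \<times> 'g) (rS :: 'g \<times> 'g \<Rightarrow> 'g \<times> 'g) (\<beta> :: 'g \<Rightarrow> 'g \<Rightarrow> 'g).
    semidirect_data (stab G A act) rS H rH \<beta> \<and>
    isomorphic_solutions
      (carrier G) (bracoid_solution G A act)
      (stab G A act \<times> H) (semidirect_solution rS H rH \<beta>)"
proof -
  interpret almost_brace G A act H
    using assms by (intro almost_brace.intro almost_brace_axioms.intro)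
  show ?thesis
    using semidirect_data_gamma bracoid_solution_ybe split_solution_iso
      ybe_solution_transport[OF bracoid_solution_ybe split_solution_iso]
    unfolding isomorphic_solutions_def by blast
qed

end
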